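(* If $\kappa$ is a cardinal and $V_\kappa\prec M$ for some transitive set $M$ with $V_{\kappa+1}\subseteq M$, then $\kappa$ is neither first-order nor second-order theory categorical.
   Context: $V_\kappa$ is the rank-initial segment of the cumulative hierarchy, and $\prec$ denotes first-order elementary substructure in the language $\{\in\}$. A cardinal $\kappa$ is first-order (resp. second-order) theory categorical if $\kappa$ is inaccessible and there is a first-order (resp. second-order, with second-order quantifiers over all subsets of $V_\kappa$) theory $T$ with $V_\kappa\models T$ and $V_\lambda\not\models T$ for every inaccessible $\lambda\neq\kappa$. *)

theory Defs
  imports Main "HOL-Library.Equipollence" "HOL-Library.Countable_Set"
begin

text \<open>
  The ambient set-theoretic universe is a type satisfying the axioms of ZFC, with replacement
  for arbitrary HOL functions and foundation for arbitrary HOL predicates. Separation and choice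
  follow from replacement and from Hilbert choice respectively. Consequently every HOL subset of
  a set, and every HOL function between sets, is (the extension of) a set.
\<close>

class zfc =
  fixes elts :: "'a \<Rightarrow> 'a set"
  assumes extensionality: "elts x = elts y \<Longrightarrow> x = y"
    and foundation: "wf {(x, y). x \<in> elts y}"
    and pairing: "\<exists>z. elts z = {x, y}"
    and union: "\<exists>z. elts z = (\<Union>y\<in>elts x. elts y)"
    and powerset: "\<exists>z. elts z = {y. elts y \<subseteq> elts x}"
    and replacement: "\<exists>z. elts z = f ` elts x"
    and infinity: "\<exists>w. (\<exists>z\<in>elts w. elts z = {}) \<and>
                       (\<forall>x\<in>elts w. \<exists>y\<in>elts w. elts y = insert x (elts x))"

text \<open>Unspecified when \<^term>\<open>X\<close> is a proper class.\<close>
definition set_of :: "'v::zfc set \<Rightarrow> 'v"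
  where "set_of X = (THE x. elts x = X)"

definition small :: "'v::zfc set \<Rightarrow> bool"
  where "small X \<longleftrightarrow> (\<exists>x. elts x = X)"

lemma elts_set_of: "small X \<Longrightarrow> elts (set_of X) = X"
proof -
  assume "small X"
  then obtain x where x: "elts x = X" unfolding small_def ..
  have "set_of X = x"
    unfolding set_of_def by (rule the_equality) (simp_all add: x extensionality)
  then show ?thesis using x by simp
qed

lemma small_elts: "small (elts x)"
  by (auto simp: small_def)

lemma small_image: "small X \<Longrightarrow> small (f ` X)" for f :: "'v::zfc \<Rightarrow> 'v"
proof -
  assume "small X"
  then obtain x where x: "elts x = X" unfolding small_def ..
  show ?thesis unfolding small_def x[symmetric] by (rule replacement)
qed

lemma small_subset:
  assumes "small X" "Y \<subseteq> X" shows "small Y"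
proof (cases "Y = {}")
  case True
  then show ?thesis using infinity by (auto simp: small_def)
next
  case False
  then obtain a where "a \<in> Y" by blast
  then have "Y = (\<lambda>x. if x \<in> Y then x else a) ` X" using assms(2) by auto
  then show ?thesis using small_image[OF assms(1)] by metis
qed

lemma small_UN:
  fixes F :: "'v::zfc \<Rightarrow> 'v set"
  assumes "small X" "\<And>x. x \<in> X \<Longrightarrow> small (F x)" shows "small (\<Union>x\<in>X. F x)"
proof -
  obtain z where z: "elts z = (\<lambda>x. set_of (F x)) ` X"
    using small_image[OF assms(1)] unfolding small_def by blast
  obtain u where "elts u = (\<Union>y\<in>elts z. elts y)" using union by blast
  also have "\<dots> = (\<Union>x\<in>X. F x)" using assms(2) by (simp add: z elts_set_of)
  finally show ?thesis by (auto simp: small_def)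
qed

lemma small_insert:
  assumes "small X" shows "small (insert a X)"
proof -
  obtain x where x: "elts x = X" using assms by (auto simp: small_def)
  obtain s where s: "elts s = {a}" using pairing[of a a] by auto
  obtain p where p: "elts p = {s, x}" using pairing by blast
  obtain u where "elts u = (\<Union>y\<in>elts p. elts y)" using union by blast
  then have "elts u = insert a X" by (simp add: p s x)
  then show ?thesis by (auto simp: small_def)
qed


definition Transset :: "'v::zfc \<Rightarrow> bool"
  where "Transset x \<longleftrightarrow> (\<forall>y\<in>elts x. elts y \<subseteq> elts x)"

definition Ord :: "'v::zfc \<Rightarrow> bool"
  where "Ord \<alpha> \<longleftrightarrow> Transset \<alpha> \<and> (\<forall>x\<in>elts \<alpha>. Transset x)"

definition succ :: "'v::zfc \<Rightarrow> 'v"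
  where "succ \<alpha> = set_of (insert \<alpha> (elts \<alpha>))"

lemma elts_succ: "elts (succ \<alpha>) = insert \<alpha> (elts \<alpha>)"
  by (simp add: succ_def elts_set_of small_insert small_elts)

definition Card :: "'v::zfc \<Rightarrow> bool"
  where "Card \<kappa> \<longleftrightarrow> Ord \<kappa> \<and> (\<forall>\<alpha>\<in>elts \<kappa>. \<not> elts \<alpha> \<approx> elts \<kappa>)"

definition regular :: "'v::zfc \<Rightarrow> bool"
  where "regular \<kappa> \<longleftrightarrow> Card \<kappa> \<and> infinite (elts \<kappa>) \<and>
    (\<forall>X\<subseteq>elts \<kappa>. X \<prec> elts \<kappa> \<longrightarrow> (\<exists>\<beta>\<in>elts \<kappa>. X \<subseteq> elts \<beta>))"

definition strong_limit :: "'v::zfc \<Rightarrow> bool"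
  where "strong_limit \<kappa> \<longleftrightarrow> Card \<kappa> \<and> (\<forall>\<alpha>\<in>elts \<kappa>. Pow (elts \<alpha>) \<prec> elts \<kappa>)"

definition inaccessible :: "'v::zfc \<Rightarrow> bool"
  where "inaccessible \<kappa> \<longleftrightarrow> uncountable (elts \<kappa>) \<and> regular \<kappa> \<and> strong_limit \<kappa>"

text \<open>The cumulative hierarchy: \<open>V\<^sub>\<alpha>\<close> is the union of the power sets of the \<open>V\<^sub>\<beta>\<close>, \<open>\<beta> \<in> \<alpha>\<close>.\<close>
function Vset :: "'v::zfc \<Rightarrow> 'v"
  where "Vset \<alpha> = set_of (\<Union>\<beta>\<in>elts \<alpha>. {x. elts x \<subseteq> elts (Vset \<beta>)})"
  by auto
termination
  by (relation "{(x, y). x \<in> elts y}") (simp_all add: foundation)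

declare Vset.simps [simp del]

lemma elts_Vset: "elts (Vset \<alpha>) = (\<Union>\<beta>\<in>elts \<alpha>. {x. elts x \<subseteq> elts (Vset \<beta>)})"
proof -
  have "small {x. elts x \<subseteq> elts (Vset \<beta>)}" for \<beta> :: 'a
    using powerset by (auto simp: small_def)
  then show ?thesis
    by (subst Vset.simps) (simp add: elts_set_of small_UN small_elts)
qed


text \<open>First-order formulas in the language of set theory; variables are natural numbers.\<close>
datatype fm =
    Mem nat nat
  | Eq nat nat
  | Neg fm
  | And fm fm
  | All nat fm

primrec fv :: "fm \<Rightarrow> nat set" where
  "fv (Mem i j) = {i, j}"
| "fv (Eq i j) = {i, j}"
| "fv (Neg p) = fv p"
| "fv (And p q) = fv p \<union> fv q"
| "fv (All i p) = fv p - {i}"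

primrec sat :: "'v::zfc \<Rightarrow> (nat \<Rightarrow> 'v) \<Rightarrow> fm \<Rightarrow> bool" where
  "sat M e (Mem i j) \<longleftrightarrow> e i \<in> elts (e j)"
| "sat M e (Eq i j) \<longleftrightarrow> e i = e j"
| "sat M e (Neg p) \<longleftrightarrow> \<not> sat M e p"
| "sat M e (And p q) \<longleftrightarrow> sat M e p \<and> sat M e q"
| "sat M e (All i p) \<longleftrightarrow> (\<forall>a\<in>elts M. sat M (e(i := a)) p)"

definition elem_substructure :: "'v::zfc \<Rightarrow> 'v \<Rightarrow> bool"
  where "elem_substructure N M \<longleftrightarrow> elts N \<subseteq> elts M \<and>
    (\<forall>p e. e ` fv p \<subseteq> elts N \<longrightarrow> (sat N e p \<longleftrightarrow> sat M e p))"

definition fo_theory :: "fm set \<Rightarrow> bool"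
  where "fo_theory T \<longleftrightarrow> (\<forall>p\<in>T. fv p = {})"

text \<open>For sentences the truth value does not depend on the assignment.\<close>
definition fo_models :: "'v::zfc \<Rightarrow> fm set \<Rightarrow> bool"
  where "fo_models M T \<longleftrightarrow> (\<forall>p\<in>T. \<forall>e. sat M e p)"

text \<open>
  Second-order formulas, with separate first-order and (unary) second-order variables.
  \<open>MemC2 i j\<close> says that the individual \<open>i\<close> belongs to the class \<open>j\<close>.
\<close>
datatype fm2 =
    Mem2 nat nat
  | Eq2 nat nat
  | MemC2 nat nat
  | Neg2 fm2
  | And2 fm2 fm2
  | All2 nat fm2
  | AllC2 nat fm2

primrec fv2 :: "fm2 \<Rightarrow> nat set" where
  "fv2 (Mem2 i j) = {i, j}"
| "fv2 (Eq2 i j) = {i, j}"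
| "fv2 (MemC2 i j) = {i}"
| "fv2 (Neg2 p) = fv2 p"
| "fv2 (And2 p q) = fv2 p \<union> fv2 q"
| "fv2 (All2 i p) = fv2 p - {i}"
| "fv2 (AllC2 j p) = fv2 p"

primrec fvC2 :: "fm2 \<Rightarrow> nat set" where
  "fvC2 (Mem2 i j) = {}"
| "fvC2 (Eq2 i j) = {}"
| "fvC2 (MemC2 i j) = {j}"
| "fvC2 (Neg2 p) = fvC2 p"
| "fvC2 (And2 p q) = fvC2 p \<union> fvC2 q"
| "fvC2 (All2 i p) = fvC2 p"
| "fvC2 (AllC2 j p) = fvC2 p - {j}"

primrec sat2 :: "'v::zfc \<Rightarrow> (nat \<Rightarrow> 'v) \<Rightarrow> (nat \<Rightarrow> 'v set) \<Rightarrow> fm2 \<Rightarrow> bool" where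
  "sat2 M e E (Mem2 i j) \<longleftrightarrow> e i \<in> elts (e j)"
| "sat2 M e E (Eq2 i j) \<longleftrightarrow> e i = e j"
| "sat2 M e E (MemC2 i j) \<longleftrightarrow> e i \<in> E j"
| "sat2 M e E (Neg2 p) \<longleftrightarrow> \<not> sat2 M e E p"
| "sat2 M e E (And2 p q) \<longleftrightarrow> sat2 M e E p \<and> sat2 M e E q"
| "sat2 M e E (All2 i p) \<longleftrightarrow> (\<forall>a\<in>elts M. sat2 M (e(i := a)) E p)"
| "sat2 M e E (AllC2 j p) \<longleftrightarrow> (\<forall>A\<subseteq>elts M. sat2 M e (E(j := A)) p)"

definition so_theory :: "fm2 set \<Rightarrow> bool"
  where "so_theory T \<longleftrightarrow> (\<forall>p\<in>T. fv2 p = {} \<and> fvC2 p = {})"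

definition so_models :: "'v::zfc \<Rightarrow> fm2 set \<Rightarrow> bool"
  where "so_models M T \<longleftrightarrow> (\<forall>p\<in>T. \<forall>e E. sat2 M e E p)"


definition fo_theory_categorical :: "'v::zfc \<Rightarrow> bool"
  where "fo_theory_categorical \<kappa> \<longleftrightarrow> inaccessible \<kappa> \<and>
    (\<exists>T. fo_theory T \<and> fo_models (Vset \<kappa>) T \<and>
      (\<forall>\<mu>. inaccessible \<mu> \<and> \<mu> \<noteq> \<kappa> \<longrightarrow> \<not> fo_models (Vset \<mu>) T))"

definition so_theory_categorical :: "'v::zfc \<Rightarrow> bool"
  where "so_theory_categorical \<kappa> \<longleftrightarrow> inaccessible \<kappa> \<and>
    (\<exists>T. so_theory T \<and> so_models (Vset \<kappa>) T \<and>
      (\<forall>\<mu>. inaccessible \<mu> \<and> \<mu> \<noteq> \<kappa> \<longrightarrow> \<not> so_models (Vset \<mu>) T))"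

end

theory Submission
  imports Defs
begin

text \<open>
  Second-order logic over \<open>V\<^sub>\<delta>\<close> is first-order logic over \<open>\<P>(V\<^sub>\<delta>) = V\<^bsub>\<delta>+1\<^esub>\<close>, and a theory is, up
  to coding, an element \<open>t\<close> of \<open>V\<^sub>\<kappa>\<close>. An assignment in \<open>V\<^bsub>\<delta>+1\<^esub>\<close> is coded by a single \<open>F \<subseteq> V\<^sub>\<delta>\<close>
  giving the variable \<open>i\<close> the value \<open>{x. \<langle>i, x\<rangle> \<in> F}\<close>. Hence the inaccessibility of \<open>\<delta>\<close> and the
  fact that \<open>S\<close> is a truth set for \<open>V\<^bsub>\<delta>+1\<^esub>\<close> need no quantifiers except bounded ones and those over
  subsets of \<open>V\<^sub>\<delta>\<close>. Such properties are absolute for every transitive structure containing these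
  subsets: for \<open>V\<^sub>\<kappa>\<close> when \<open>\<delta> < \<kappa>\<close>, and for \<open>M\<close> when \<open>\<delta> = \<kappa>\<close>. In \<open>V\<^sub>\<kappa>\<close> every \<open>V\<^bsub>\<delta>+1\<^esub>\<close> with \<open>\<delta>\<close>
  inaccessible has a truth set, hence by elementarity \<open>M\<close> contains one for \<open>V\<^bsub>\<kappa>+1\<^esub>\<close>. Thus \<open>M\<close>
  thinks that \<open>V\<^sub>\<delta> \<Turnstile> t\<close> for some inaccessible \<open>\<delta>\<close>, and by elementarity so does \<open>V\<^sub>\<kappa>\<close>.
\<close>

section \<open>Sets, pairs and the cumulative hierarchy\<close>

lemma elts_induct [case_names step]:
  fixes x :: "'v::zfc"
  assumes "\<And>x. (\<And>y. y \<in> elts x \<Longrightarrow> P y) \<Longrightarrow> P x"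
  shows "P x"
  using foundation by (rule wf_induct_rule) (use assms in auto)

lemma elts_irrefl: "x \<notin> elts (x::'v::zfc)"
  using wf_irrefl[OF foundation, of x] by auto

lemma elts_eq_iff: "elts x = elts y \<longleftrightarrow> x = (y::'v::zfc)"
  using extensionality by blast

lemma small_finite: "finite X \<Longrightarrow> small (X :: 'v::zfc set)"
proof (induction rule: finite_induct)
  case empty
  show ?case by (rule small_subset[OF small_elts]) simp
qed (simp add: small_insert)

lemma elts_set_of_finite [simp]: "finite X \<Longrightarrow> elts (set_of X) = (X :: 'v::zfc set)"
  by (simp add: elts_set_of small_finite)

lemma set_of_elts: "set_of (elts x) = x"
  by (simp add: elts_set_of extensionality small_elts)

lemma elts_set_of_subset: "Y \<subseteq> elts x \<Longrightarrow> elts (set_of Y) = Y"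
  by (meson elts_set_of small_elts small_subset)

definition vpair :: "'v::zfc \<Rightarrow> 'v \<Rightarrow> 'v"
  where "vpair a b = set_of {set_of {a}, set_of {a, b}}"

lemma elts_vpair: "elts (vpair a b) = {set_of {a}, set_of {a, b}}"
  by (simp add: vpair_def)

lemma eq_set_of_finite_iff: "finite X \<Longrightarrow> x = set_of X \<longleftrightarrow> elts x = (X :: 'v::zfc set)"
  by (metis elts_set_of_finite extensionality)

lemma vpair_inject [simp]: "vpair a b = vpair c d \<longleftrightarrow> a = c \<and> b = (d :: 'v::zfc)"
  unfolding vpair_def by (auto simp: eq_set_of_finite_iff doubleton_eq_iff)

definition vpow :: "'v::zfc \<Rightarrow> 'v"
  where "vpow x = set_of {y. elts y \<subseteq> elts x}"

lemma elts_vpow [simp]: "elts (vpow x) = {y. elts y \<subseteq> elts x}"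
  unfolding vpow_def by (rule elts_set_of) (use powerset in \<open>auto simp: small_def\<close>)

lemma Pow_elts: "Pow (elts x) = elts ` elts (vpow x)"
  by (auto simp: image_iff) (metis elts_set_of_subset)

lemma TranssetD: "Transset x \<Longrightarrow> y \<in> elts x \<Longrightarrow> z \<in> elts y \<Longrightarrow> z \<in> elts x"
  unfolding Transset_def by blast

lemma vpair_in_TranssetD:
  assumes "Transset x" "vpair a b \<in> elts x" shows "a \<in> elts x" "b \<in> elts x"
proof -
  have "set_of {a, b} \<in> elts x" using assms by (rule TranssetD) (simp add: elts_vpair)
  then show "a \<in> elts x" "b \<in> elts x" using assms(1) by (auto intro: TranssetD)
qed

lemma mem_Vset_iff: "x \<in> elts (Vset \<alpha>) \<longleftrightarrow> (\<exists>\<beta>\<in>elts \<alpha>. elts x \<subseteq> elts (Vset \<beta>))"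
  by (subst elts_Vset) auto

lemma VsetI: "\<beta> \<in> elts \<alpha> \<Longrightarrow> elts x \<subseteq> elts (Vset \<beta>) \<Longrightarrow> x \<in> elts (Vset \<alpha>)"
  using mem_Vset_iff by blast

lemma VsetE:
  assumes "x \<in> elts (Vset \<alpha>)"
  obtains \<beta> where "\<beta> \<in> elts \<alpha>" "elts x \<subseteq> elts (Vset \<beta>)"
  using assms mem_Vset_iff by blast

lemma Vset_subset_closed: "x \<in> elts (Vset \<alpha>) \<Longrightarrow> elts y \<subseteq> elts x \<Longrightarrow> y \<in> elts (Vset \<alpha>)"
  by (meson VsetE VsetI subset_trans)

lemma Transset_Vset: "Transset (Vset \<alpha>)"
proof (induction \<alpha> rule: elts_induct)
  case (step \<alpha>)
  show ?case unfolding Transset_def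
  proof (intro ballI subsetI)
    fix x y assume "x \<in> elts (Vset \<alpha>)" "y \<in> elts x"
    then obtain \<beta> where "\<beta> \<in> elts \<alpha>" "y \<in> elts (Vset \<beta>)" by (meson VsetE subsetD)
    then show "y \<in> elts (Vset \<alpha>)" using step by (meson Transset_def VsetI)
  qed
qed

lemma Vset_mono: "\<beta> \<in> elts \<alpha> \<Longrightarrow> elts (Vset \<beta>) \<subseteq> elts (Vset \<alpha>)"
  by (meson Transset_Vset Transset_def VsetI subsetI)

lemma elts_subset_Vset: "elts \<alpha> \<subseteq> elts (Vset \<alpha>)"
proof (induction \<alpha> rule: elts_induct)
  case (step \<alpha>)
  then show ?case by (meson VsetI subsetI)
qed

lemma Vset_succ: "Vset (succ \<alpha>) = vpow (Vset \<alpha>)"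
proof (rule extensionality)
  show "elts (Vset (succ \<alpha>)) = elts (vpow (Vset \<alpha>))"
    using Vset_mono[of _ \<alpha>]
    by (simp add: set_eq_iff mem_Vset_iff[of _ "succ \<alpha>"] elts_succ) (meson subset_trans)
qed

section \<open>Codes for countable types\<close>

primrec vnat :: "nat \<Rightarrow> 'v::zfc" where
  "vnat 0 = set_of {}"
| "vnat (Suc n) = succ (vnat n)"

lemma elts_vnat: "elts (vnat n) = vnat ` {..<n}"
  by (induction n) (simp_all add: elts_succ lessThan_Suc)

lemma inj_vnat: "inj (vnat :: nat \<Rightarrow> 'v::zfc)"
proof -
  have "vnat m \<noteq> (vnat n :: 'v)" if "m < n" for m n
    using that elts_irrefl[of "vnat n :: 'v"] by (metis elts_vnat image_eqI lessThan_iff)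
  then show ?thesis by (metis injI linorder_neqE_nat)
qed

lemma small_range_vnat: "small (range (vnat :: nat \<Rightarrow> 'v::zfc))"
proof -
  obtain w :: 'v where empty: "\<exists>z\<in>elts w. elts z = {}"
    and succ: "\<forall>x\<in>elts w. \<exists>y\<in>elts w. elts y = insert x (elts x)"
    using infinity by metis
  have "vnat n \<in> elts w" for n
  proof (induction n)
    case 0
    show ?case
      using empty by (metis elts_set_of_finite extensionality finite.emptyI vnat.simps(1))
  next
    case (Suc n)
    then obtain y where "y \<in> elts w" "elts y = elts (succ (vnat n))"
      using succ unfolding elts_succ by auto
    then show ?case by (metis extensionality vnat.simps(2))
  qed
  then show ?thesis by (intro small_subset[OF small_elts[of w]]) auto
qed

lemma small_countable:
  fixes X :: "'v::zfc set"
  assumes "countable X" shows "small X"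
proof (cases "X = {}")
  case True
  then show ?thesis by (simp add: small_finite)
next
  case False
  then have "X = (from_nat_into X \<circ> inv vnat) ` range (vnat :: nat \<Rightarrow> 'v)"
    using assms by (simp add: image_image inv_f_f[OF inj_vnat])
  then show ?thesis using small_image[OF small_range_vnat] by metis
qed

lemma elts_set_of_countable: "countable X \<Longrightarrow> elts (set_of X) = (X :: 'v::zfc set)"
  by (simp add: elts_set_of small_countable)

definition omega :: "'v::zfc"
  where "omega = set_of (range vnat)"

lemma elts_omega: "elts omega = range vnat"
  by (simp add: omega_def elts_set_of small_range_vnat)

definition code :: "'a::countable \<Rightarrow> 'v::zfc"
  where "code x = vnat (to_nat x)"

lemma code_eq_iff [simp]: "code x = (code y :: 'v::zfc) \<longleftrightarrow> x = y"
  by (simp add: code_def inj_eq[OF inj_vnat])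

lemma code_in_omega: "code x \<in> elts omega"
  by (simp add: code_def elts_omega)

section \<open>Closure under countable subsets\<close>

definition countably_closed :: "'v::zfc set \<Rightarrow> bool"
  where "countably_closed C \<longleftrightarrow> (\<forall>Y\<subseteq>C. countable Y \<longrightarrow> set_of Y \<in> C)"

lemma countably_closedD: "countably_closed C \<Longrightarrow> Y \<subseteq> C \<Longrightarrow> countable Y \<Longrightarrow> set_of Y \<in> C"
  by (simp add: countably_closed_def)

lemma vpair_in_countably_closed:
  "countably_closed C \<Longrightarrow> a \<in> C \<Longrightarrow> b \<in> C \<Longrightarrow> vpair a b \<in> C"
  unfolding vpair_def by (simp add: countably_closedD)

lemma vnat_in_countably_closed:
  assumes "countably_closed C" shows "vnat n \<in> C"
proof (induction n rule: less_induct)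
  case (less n)
  then have "set_of (elts (vnat n)) \<in> C"
    using assms by (intro countably_closedD) (auto simp: elts_vnat)
  then show ?case by (simp add: set_of_elts)
qed

lemma omega_in_countably_closed: "countably_closed C \<Longrightarrow> omega \<in> C"
  unfolding omega_def by (auto intro: countably_closedD vnat_in_countably_closed)

lemma code_in_countably_closed: "countably_closed C \<Longrightarrow> code x \<in> C"
  by (simp add: code_def vnat_in_countably_closed)

section \<open>Inaccessible cardinals\<close>

lemma lepoll_total: "A \<lesssim> B \<or> B \<lesssim> A"
  unfolding lepoll_def card_of_ordLeq by (rule ordLeq_total) (rule card_of_Well_order)+

lemma lesspoll_iff_not_lepoll: "A \<prec> B \<longleftrightarrow> \<not> B \<lesssim> A"
  using lepoll_total[of A B] lepoll_antisym eqpoll_imp_lepoll eqpoll_sym unfolding lesspoll_def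
  by blast

lemma countable_iff_lepoll_omega: "countable (X :: 'v::zfc set) \<longleftrightarrow> X \<lesssim> elts (omega :: 'v)"
proof
  assume "countable X"
  then obtain f :: "'v \<Rightarrow> nat" where "inj_on f X" by (rule countableE)
  then have "inj_on (vnat \<circ> f :: 'v \<Rightarrow> 'v) X"
    by (intro comp_inj_on inj_on_subset[OF inj_vnat]) auto
  then show "X \<lesssim> elts (omega :: 'v)" unfolding lepoll_def by (auto simp: elts_omega)
next
  assume "X \<lesssim> elts (omega :: 'v)"
  then show "countable X" by (rule countable_lepoll[rotated]) (simp add: elts_omega)
qed

lemma inaccessible_iff:
  fixes \<delta> :: "'v::zfc"
  shows "inaccessible \<delta> \<longleftrightarrow> Ord \<delta> \<and> \<not> elts \<delta> \<lesssim> elts (omega :: 'v) \<and>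
    (\<forall>Y. elts Y \<subseteq> elts \<delta> \<longrightarrow> \<not> elts \<delta> \<lesssim> elts Y \<longrightarrow> (\<exists>\<beta>\<in>elts \<delta>. elts Y \<subseteq> elts \<beta>)) \<and>
    (\<forall>\<alpha>\<in>elts \<delta>. \<not> elts \<delta> \<lesssim> elts (vpow \<alpha>))"
proof -
  have regular: "(\<forall>Y\<subseteq>elts \<delta>. Y \<prec> elts \<delta> \<longrightarrow> (\<exists>\<beta>\<in>elts \<delta>. Y \<subseteq> elts \<beta>)) \<longleftrightarrow>
    (\<forall>Y. elts Y \<subseteq> elts \<delta> \<longrightarrow> \<not> elts \<delta> \<lesssim> elts Y \<longrightarrow> (\<exists>\<beta>\<in>elts \<delta>. elts Y \<subseteq> elts \<beta>))"
    by (metis elts_set_of_subset lesspoll_iff_not_lepoll)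
  have strong: "Pow (elts \<alpha>) \<prec> elts \<delta> \<longleftrightarrow> \<not> elts \<delta> \<lesssim> elts (vpow \<alpha>)" for \<alpha>
    by (simp add: lesspoll_iff_not_lepoll Pow_elts inj_on_def extensionality)
  have "\<not> elts \<alpha> \<approx> elts \<delta>" if "Pow (elts \<alpha>) \<prec> elts \<delta>" for \<alpha>
    using lesspoll_trans[OF lesspoll_Pow_self that] by (simp add: lesspoll_def)
  then have card: "(\<forall>\<alpha>\<in>elts \<delta>. Pow (elts \<alpha>) \<prec> elts \<delta>) \<longrightarrow> (\<forall>\<alpha>\<in>elts \<delta>. \<not> elts \<alpha> \<approx> elts \<delta>)"
    by blast
  show ?thesis
    unfolding inaccessible_def regular_def strong_limit_def Card_def regular
      countable_iff_lepoll_omega[symmetric] strong[symmetric]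
    using card countable_finite[of "elts \<delta>"] by argo
qed

lemma inaccessible_bounded_countable:
  assumes "inaccessible \<kappa>" "countable Y" "Y \<subseteq> elts \<kappa>"
  shows "\<exists>\<beta>\<in>elts \<kappa>. Y \<subseteq> elts \<beta>"
proof -
  have "Y \<prec> elts \<kappa>"
    using assms(1,2) countable_lepoll unfolding inaccessible_def lesspoll_iff_not_lepoll by blast
  then show ?thesis using assms(1,3) unfolding inaccessible_def regular_def by blast
qed

lemma countably_closed_Vset:
  assumes "inaccessible \<kappa>" shows "countably_closed (elts (Vset \<kappa>))"
  unfolding countably_closed_def
proof (intro allI impI)
  fix Y assume Y: "Y \<subseteq> elts (Vset \<kappa>)" "countable Y"
  then obtain f where f: "\<And>y. y \<in> Y \<Longrightarrow> f y \<in> elts \<kappa> \<and> elts y \<subseteq> elts (Vset (f y))"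
    by (metis VsetE subsetD)
  then obtain \<beta> where \<beta>: "\<beta> \<in> elts \<kappa>" "f ` Y \<subseteq> elts \<beta>"
    using inaccessible_bounded_countable[OF assms, of "f ` Y"] Y(2) by auto
  then have "Y \<subseteq> elts (Vset \<beta>)" using f by (meson VsetI image_subset_iff subsetI)
  then show "set_of Y \<in> elts (Vset \<kappa>)"
    using \<beta>(1) Y(2) by (intro VsetI) (simp_all add: elts_set_of_countable)
qed

lemma vpow_in_Vset:
  assumes "inaccessible \<kappa>" "x \<in> elts (Vset \<kappa>)"
  shows "vpow x \<in> elts (Vset \<kappa>)"
proof -
  obtain \<alpha> where "\<alpha> \<in> elts \<kappa>" "elts x \<subseteq> elts (Vset \<alpha>)" using assms(2) by (rule VsetE)
  moreover obtain \<beta> where "\<beta> \<in> elts \<kappa>" "\<alpha> \<in> elts \<beta>"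
    using inaccessible_bounded_countable[OF assms(1), of "{\<alpha>}"] calculation(1) by auto
  ultimately have "elts (vpow x) \<subseteq> elts (Vset \<beta>)" by (auto intro!: VsetI[of \<alpha> \<beta>])
  then show ?thesis using \<open>\<beta> \<in> elts \<kappa>\<close> by (rule VsetI[rotated])
qed

lemma omega_subset_Vset: "inaccessible \<kappa> \<Longrightarrow> elts omega \<subseteq> elts (Vset \<kappa>)"
  using vnat_in_countably_closed[OF countably_closed_Vset] by (auto simp: elts_omega)

section \<open>Relevance and renaming of variables\<close>

lemma sat2_cong:
  assumes "\<And>i. i \<in> fv2 p \<Longrightarrow> e i = e' i" "\<And>j. j \<in> fvC2 p \<Longrightarrow> E j = E' j"
  shows "sat2 M e E p \<longleftrightarrow> sat2 M e' E' p"
  using assms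
proof (induction p arbitrary: e e' E E')
  case (And2 p q)
  have "sat2 M e E p \<longleftrightarrow> sat2 M e' E' p" "sat2 M e E q \<longleftrightarrow> sat2 M e' E' q"
    using And2.prems by (auto intro!: And2.IH)
  then show ?case by simp
next
  case (Neg2 p)
  have "sat2 M e E p \<longleftrightarrow> sat2 M e' E' p"
    using Neg2.prems by (auto intro!: Neg2.IH)
  then show ?case by simp
next
  case (All2 i p)
  have "sat2 M (e(i := a)) E p \<longleftrightarrow> sat2 M (e'(i := a)) E' p" for a
    by (rule All2.IH) (use All2.prems in auto)
  then show ?case by simp
next
  case (AllC2 j p)
  have "sat2 M e (E(j := A)) p \<longleftrightarrow> sat2 M e' (E'(j := A)) p" for A
    by (rule AllC2.IH) (use AllC2.prems in auto)
  then show ?case by simp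
qed simp_all

primrec fo_to_so :: "fm \<Rightarrow> fm2" where
  "fo_to_so (Mem i j) = Mem2 i j"
| "fo_to_so (Eq i j) = Eq2 i j"
| "fo_to_so (Neg p) = Neg2 (fo_to_so p)"
| "fo_to_so (And p q) = And2 (fo_to_so p) (fo_to_so q)"
| "fo_to_so (All i p) = All2 i (fo_to_so p)"

lemma fv2_fo_to_so [simp]: "fv2 (fo_to_so p) = fv p"
  and fvC2_fo_to_so [simp]: "fvC2 (fo_to_so p) = {}"
  by (induction p) auto

lemma sat2_fo_to_so [simp]: "sat2 M e E (fo_to_so p) \<longleftrightarrow> sat M e p"
  by (induction p arbitrary: e) auto

lemma sat_cong: "(\<And>i. i \<in> fv p \<Longrightarrow> e i = e' i) \<Longrightarrow> sat M e p \<longleftrightarrow> sat M e' p"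
  using sat2_cong[of "fo_to_so p" e e' "\<lambda>_. {}" "\<lambda>_. {}" M] by simp

lemma finite_fv: "finite (fv p)"
  by (induction p) auto

lemma ex_fm_renaming: "\<exists>q. \<forall>(M :: 'v::zfc) e. sat M e q \<longleftrightarrow> sat M (e \<circ> f) p"
proof (induction p arbitrary: f)
  case (Mem i j)
  show ?case by (rule exI[of _ "Mem (f i) (f j)"]) simp
next
  case (Eq i j)
  show ?case by (rule exI[of _ "Eq (f i) (f j)"]) simp
next
  case (Neg p)
  then show ?case by (metis sat.simps(3))
next
  case (And p q)
  then show ?case by (metis sat.simps(4))
next
  case (All i p)
  obtain k where k: "k \<notin> f ` fv p"
    using ex_new_if_finite finite_fv by (metis finite_imageI infinite_UNIV_nat)
  obtain q where q: "\<And>(M :: 'v) e. sat M e q \<longleftrightarrow> sat M (e \<circ> f(i := k)) p"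
    using All.IH by metis
  have "sat M (e(k := a)) q \<longleftrightarrow> sat M ((e \<circ> f)(i := a)) p" for M :: 'v and e a
    unfolding q using k by (intro sat_cong) auto
  then show ?case by (metis sat.simps(5))
qed

section \<open>Uniformly definable predicates\<close>

datatype 'v param = Base | Const 'v | Var nat

primrec param_val :: "'v \<Rightarrow> (nat \<Rightarrow> 'v) \<Rightarrow> 'v param \<Rightarrow> 'v" where
  "param_val X e Base = X"
| "param_val X e (Const c) = c"
| "param_val X e (Var n) = e n"

primrec param_subst :: "'v param \<Rightarrow> 'v param \<Rightarrow> 'v param" where
  "param_subst t Base = Base"
| "param_subst t (Const c) = Const c"
| "param_subst t (Var n) = case_nat t Var n"

lemma param_val_subst:
  "param_val X e (param_subst t s) = param_val X (case_nat (param_val X e t) e) s"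
  by (cases s) (simp_all split: nat.split)

lemma set_param_subst: "set_param (param_subst t s) \<subseteq> set_param s \<union> set_param t"
  by (cases s) (simp_all split: nat.split)

definition admissible :: "'v::zfc set \<Rightarrow> 'v \<Rightarrow> 'v \<Rightarrow> bool"
  where "admissible C M X \<longleftrightarrow> Transset M \<and> C \<subseteq> elts M \<and> elts (vpow X) \<subseteq> elts M"

text \<open>In \<open>Q X e\<close> the environment \<open>e\<close> is read in de Bruijn style: quantifiers bind \<open>e 0\<close> and shift
  the other variables. Since \<open>Q\<close> does not depend on \<open>M\<close>, a definable predicate is absolute.\<close>
definition uniformly_defines ::
    "'v::zfc set \<Rightarrow> fm \<Rightarrow> (nat \<Rightarrow> 'v param) \<Rightarrow> ('v \<Rightarrow> (nat \<Rightarrow> 'v) \<Rightarrow> bool) \<Rightarrow> bool"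
  where "uniformly_defines C p v Q \<longleftrightarrow> (\<forall>i. set_param (v i) \<subseteq> C) \<and>
    (\<forall>M X e. admissible C M X \<longrightarrow> range e \<subseteq> elts M \<longrightarrow> (sat M (param_val X e \<circ> v) p \<longleftrightarrow> Q X e))"

lemma uniformly_defines_sat_iff:
  assumes "uniformly_defines C p v Q" "admissible C M X" "range e \<subseteq> elts M"
  shows "sat M (param_val X e \<circ> v) p \<longleftrightarrow> Q X e"
  using assms by (simp add: uniformly_defines_def)

definition definable :: "'v::zfc set \<Rightarrow> ('v \<Rightarrow> (nat \<Rightarrow> 'v) \<Rightarrow> bool) \<Rightarrow> bool"
  where "definable C Q \<longleftrightarrow> (\<exists>p v. uniformly_defines C p v Q)"

named_theorems definable_intro

lemma definableI: "uniformly_defines C p v Q \<Longrightarrow> definable C Q"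
  unfolding definable_def by blast

lemma definableE:
  assumes "definable C Q" obtains p v where "uniformly_defines C p v Q"
  using assms unfolding definable_def by blast

lemma param_val_in:
  assumes "admissible C M X" "range e \<subseteq> elts M" "set_param t \<subseteq> C"
  shows "param_val X e t \<in> elts M"
  using assms by (cases t) (auto simp: admissible_def)

lemma range_case_nat_subset: "a \<in> A \<Longrightarrow> range e \<subseteq> A \<Longrightarrow> range (case_nat a e) \<subseteq> A"
  by (auto simp: image_subset_iff split: nat.split)

lemma definable_mem [definable_intro]: "definable C (\<lambda>X e. e i \<in> elts (e j))"
  by (rule definableI[of _ "Mem 0 1" "\<lambda>n. Var (if n = 0 then i else j)"])
    (simp add: uniformly_defines_def)

lemma definable_eq [definable_intro]: "definable C (\<lambda>X e. e i = e j)"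
  by (rule definableI[of _ "Eq 0 1" "\<lambda>n. Var (if n = 0 then i else j)"])
    (simp add: uniformly_defines_def)

lemma definable_not [definable_intro]:
  assumes "definable C Q" shows "definable C (\<lambda>X e. \<not> Q X e)"
proof -
  obtain p v where "uniformly_defines C p v Q" using assms by (rule definableE)
  then have "uniformly_defines C (Neg p) v (\<lambda>X e. \<not> Q X e)" by (simp add: uniformly_defines_def)
  then show ?thesis by (rule definableI)
qed

lemma definable_conj [definable_intro]:
  fixes C :: "'v::zfc set"
  assumes "definable C P" "definable C Q" shows "definable C (\<lambda>X e. P X e \<and> Q X e)"
proof -
  obtain p v where p: "uniformly_defines C p v P" using assms(1) by (rule definableE)
  obtain q w where q: "uniformly_defines C q w Q" using assms(2) by (rule definableE)
  obtain p' where p': "\<And>(M :: 'v) e. sat M e p' \<longleftrightarrow> sat M (e \<circ> (\<lambda>i. 2 * i)) p"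
    using ex_fm_renaming by metis
  obtain q' where q': "\<And>(M :: 'v) e. sat M e q' \<longleftrightarrow> sat M (e \<circ> (\<lambda>i. 2 * i + 1)) q"
    using ex_fm_renaming by metis
  let ?u = "\<lambda>i. if even i then v (i div 2) else w (i div 2)"
  have "?u \<circ> (\<lambda>i. 2 * i) = v" "?u \<circ> (\<lambda>i. 2 * i + 1) = w" by auto
  then have "uniformly_defines C (And p' q') ?u (\<lambda>X e. P X e \<and> Q X e)"
    using p q by (simp add: uniformly_defines_def p' q' comp_assoc)
  then show ?thesis by (rule definableI)
qed

lemma definable_subst:
  fixes C :: "'v::zfc set"
  assumes "definable C Q" "set_param t \<subseteq> C"
  shows "definable C (\<lambda>X e. Q X (case_nat (param_val X e t) e))"
proof -
  obtain p v where p: "uniformly_defines C p v Q" using assms(1) by (rule definableE)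
  have "uniformly_defines C p (param_subst t \<circ> v) (\<lambda>X e. Q X (case_nat (param_val X e t) e))"
    unfolding uniformly_defines_def
  proof (intro conjI allI impI)
    show "set_param ((param_subst t \<circ> v) i) \<subseteq> C" for i
      using set_param_subst[of t "v i"] p assms(2) by (fastforce simp: uniformly_defines_def)
    fix M X and e :: "nat \<Rightarrow> 'v" assume M: "admissible C M X" "range e \<subseteq> elts M"
    have "param_val X e \<circ> (param_subst t \<circ> v) = param_val X (case_nat (param_val X e t) e) \<circ> v"
      by (simp add: fun_eq_iff param_val_subst)
    moreover have "range (case_nat (param_val X e t) e) \<subseteq> elts M"
      using M assms(2) by (intro range_case_nat_subset param_val_in)
    ultimately show "sat M (param_val X e \<circ> (param_subst t \<circ> v)) p \<longleftrightarrow>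
        Q X (case_nat (param_val X e t) e)"
      using uniformly_defines_sat_iff[OF p M(1)] by simp
  qed
  then show ?thesis by (rule definableI)
qed

lemma definable_base:
  assumes "definable C (\<lambda>X e. Q X (\<lambda>n. e (Suc n)) (e 0))"
  shows "definable C (\<lambda>X e. Q X e X)"
  using definable_subst[OF assms, of Base] by simp

lemma definable_const:
  assumes "definable C (\<lambda>X e. Q X (\<lambda>n. e (Suc n)) (e 0))" "c \<in> C"
  shows "definable C (\<lambda>X e. Q X e c)"
  using definable_subst[OF assms(1), of "Const c"] assms(2) by simp

lemma definable_all:
  fixes C :: "'v::zfc set"
  assumes Q: "definable C (\<lambda>X e. Q X (\<lambda>n. e (Suc n)) (e 0))"
    and counterexample_in: "\<And>M X e a. admissible C M X \<Longrightarrow> range e \<subseteq> elts M \<Longrightarrow> \<not> Q X e a \<Longrightarrow>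
      a \<in> elts M"
  shows "definable C (\<lambda>X e. \<forall>a. Q X e a)"
proof -
  obtain p v where p: "uniformly_defines C p v (\<lambda>X e. Q X (\<lambda>n. e (Suc n)) (e 0))"
    using Q by (rule definableE)
  obtain k where k: "k \<notin> fv p" using ex_new_if_finite finite_fv infinite_UNIV_nat by metis
  obtain q where q: "\<And>(M :: 'v) e. sat M e q \<longleftrightarrow> sat M (e \<circ> (\<lambda>i. if v i = Var 0 then k else i)) p"
    using ex_fm_renaming by metis
  let ?w = "param_subst Base \<circ> v"
  have "uniformly_defines C (All k q) ?w (\<lambda>X e. \<forall>a. Q X e a)"
    unfolding uniformly_defines_def
  proof (intro conjI allI impI)
    show "set_param (?w i) \<subseteq> C" for i
      using set_param_subst[of Base "v i"] p by (fastforce simp: uniformly_defines_def)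
    fix M X and e :: "nat \<Rightarrow> 'v" assume M: "admissible C M X" "range e \<subseteq> elts M"
    have "sat M ((param_val X e \<circ> ?w)(k := a)) q \<longleftrightarrow> Q X e a" if "a \<in> elts M" for a
    proof -
      have "param_val X e (param_subst Base s) = param_val X (case_nat a e) s" if "s \<noteq> Var 0" for s
        using that by (cases s) (auto split: nat.split)
      then have "sat M ((param_val X e \<circ> ?w)(k := a)) q \<longleftrightarrow> sat M (param_val X (case_nat a e) \<circ> v) p"
        unfolding q using k by (intro sat_cong) auto
      also have "\<dots> \<longleftrightarrow> Q X e a"
        using uniformly_defines_sat_iff[OF p M(1) range_case_nat_subset[OF that M(2)]] by simp
      finally show ?thesis .
    qed
    then show "sat M (param_val X e \<circ> ?w) (All k q) \<longleftrightarrow> (\<forall>a. Q X e a)"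
      using counterexample_in[OF M] by auto
  qed
  then show ?thesis by (rule definableI)
qed

lemma definable_imp [definable_intro]:
  assumes "definable C P" "definable C Q" shows "definable C (\<lambda>X e. P X e \<longrightarrow> Q X e)"
  using definable_not[OF definable_conj[OF assms(1) definable_not[OF assms(2)]]] by simp

lemma definable_disj [definable_intro]:
  assumes "definable C P" "definable C Q" shows "definable C (\<lambda>X e. P X e \<or> Q X e)"
  using definable_imp[OF definable_not[OF assms(1)] assms(2)] by (simp add: disj_imp)

lemma definable_iff [definable_intro]:
  assumes "definable C P" "definable C Q" shows "definable C (\<lambda>X e. P X e \<longleftrightarrow> Q X e)"
  using definable_conj[OF definable_imp[OF assms] definable_imp[OF assms(2,1)]]
  by (simp add: iff_conv_conj_imp)

lemma definable_ball [definable_intro]: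
  assumes "definable C (\<lambda>X e. Q X (\<lambda>n. e (Suc n)) (e 0))"
  shows "definable C (\<lambda>X e. \<forall>a\<in>elts (e i). Q X e a)"
  unfolding Ball_def
proof (rule definable_all)
  show "definable C (\<lambda>X e. e 0 \<in> elts (e (Suc i)) \<longrightarrow> Q X (\<lambda>n. e (Suc n)) (e 0))"
    by (rule definable_imp[OF definable_mem assms])
qed (auto simp: admissible_def intro: TranssetD)

lemma definable_bex [definable_intro]:
  assumes "definable C (\<lambda>X e. Q X (\<lambda>n. e (Suc n)) (e 0))"
  shows "definable C (\<lambda>X e. \<exists>a\<in>elts (e i). Q X e a)"
  using definable_not[OF definable_ball[of C "\<lambda>X e a. \<not> Q X e a",
      OF definable_not[OF assms]]] by simp

lemma definable_subset [definable_intro]: "definable C (\<lambda>X e. elts (e i) \<subseteq> elts (e j))"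
  unfolding subset_iff Ball_def[symmetric] by (intro definable_ball definable_mem)

lemma definable_mem_base [definable_intro]: "definable C (\<lambda>X e. e i \<in> elts X)"
  by (rule definable_base[where Q = "\<lambda>X e x. e i \<in> elts x"]) (rule definable_mem)

lemma definable_subset_base [definable_intro]: "definable C (\<lambda>X e. elts (e i) \<subseteq> elts X)"
  by (rule definable_base[where Q = "\<lambda>X e x. elts (e i) \<subseteq> elts x"]) (rule definable_subset)

lemma definable_mem_const: "c \<in> C \<Longrightarrow> definable C (\<lambda>X e. e i \<in> elts c)"
  by (rule definable_const[where Q = "\<lambda>X e w. e i \<in> elts w"]) (rule definable_mem)

lemma definable_ball_const:
  assumes "definable C (\<lambda>X e. Q X (\<lambda>n. e (Suc n)) (e 0))" "c \<in> C"
  shows "definable C (\<lambda>X e. \<forall>a\<in>elts c. Q X e a)"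
  unfolding Ball_def
proof (rule definable_all)
  show "definable C (\<lambda>X e. e 0 \<in> elts c \<longrightarrow> Q X (\<lambda>n. e (Suc n)) (e 0))"
    by (rule definable_imp[OF definable_mem_const[OF assms(2)] assms(1)])
qed (use assms(2) in \<open>auto simp: admissible_def intro: TranssetD\<close>)

lemma definable_all_subsets [definable_intro]:
  assumes "definable C (\<lambda>X e. Q X (\<lambda>n. e (Suc n)) (e 0))"
  shows "definable C (\<lambda>X e. \<forall>A. elts A \<subseteq> elts X \<longrightarrow> Q X e A)"
proof (rule definable_all)
  show "definable C (\<lambda>X e. elts (e 0) \<subseteq> elts X \<longrightarrow> Q X (\<lambda>n. e (Suc n)) (e 0))"
    by (rule definable_imp[OF definable_subset_base assms])
qed (auto simp: admissible_def)

lemma definable_ex_subset [definable_intro]: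
  assumes "definable C (\<lambda>X e. Q X (\<lambda>n. e (Suc n)) (e 0))"
  shows "definable C (\<lambda>X e. \<exists>A. elts A \<subseteq> elts X \<and> Q X e A)"
  using definable_not[OF definable_all_subsets[of C "\<lambda>X e A. \<not> Q X e A",
      OF definable_not[OF assms]]] by simp

lemma eq_doubleton_iff:
  "x = set_of {a, b} \<longleftrightarrow> a \<in> elts x \<and> b \<in> elts x \<and> (\<forall>y\<in>elts x. y = a \<or> y = (b :: 'v::zfc))"
  by (auto simp: eq_set_of_finite_iff)

lemma eq_vpair_iff:
  "x = vpair a b \<longleftrightarrow> (\<exists>y\<in>elts x. y = set_of {a, a}) \<and> (\<exists>y\<in>elts x. y = set_of {a, b}) \<and>
    (\<forall>y\<in>elts x. y = set_of {a, a} \<or> y = set_of {a, b :: 'v::zfc})"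
  by (auto simp: vpair_def eq_set_of_finite_iff[of "{_, _}" x])

lemma definable_eq_doubleton [definable_intro]: "definable C (\<lambda>X e. e i = set_of {e j, e k})"
  unfolding eq_doubleton_iff by (intro definable_intro)

lemma definable_eq_vpair [definable_intro]: "definable C (\<lambda>X e. e i = vpair (e j) (e k))"
  unfolding eq_vpair_iff by (intro definable_intro)

lemma definable_vpair_mem [definable_intro]: "definable C (\<lambda>X e. vpair (e i) (e j) \<in> elts (e k))"
proof -
  have "definable C (\<lambda>X e. \<exists>x\<in>elts (e k). x = vpair (e i) (e j))" by (intro definable_intro)
  then show ?thesis by simp
qed

lemma definable_triple_mem:
  "definable C (\<lambda>X e. vpair (e i) (vpair (e j) (e k)) \<in> elts (e l))"
proof -
  have "definable C (\<lambda>X e. \<exists>x\<in>elts (e l). \<exists>y\<in>elts x. \<exists>z\<in>elts y.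
      z = vpair (e j) (e k) \<and> x = vpair (e i) z)"
    by (intro definable_intro)
  moreover have "(\<exists>x\<in>elts d. \<exists>y\<in>elts x. \<exists>z\<in>elts y. z = vpair b c \<and> x = vpair a z) \<longleftrightarrow>
      vpair a (vpair b c) \<in> elts d" for a b c d :: 'a
    by (auto simp: elts_vpair)
  ultimately show ?thesis by simp
qed

section \<open>Inaccessible levels are definable\<close>

definition vpair_closed :: "'v::zfc \<Rightarrow> bool"
  where "vpair_closed X \<longleftrightarrow> Transset X \<and> (\<forall>x\<in>elts X. \<forall>y\<in>elts X. vpair x y \<in> elts X)"

lemma definable_vpair_closed [definable_intro]: "definable C (\<lambda>X e. vpair_closed X)"
proof (rule definable_base)
  show "definable C (\<lambda>X e. vpair_closed (e 0))"
    unfolding vpair_closed_def Transset_def by (intro definable_intro)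
qed

lemma vpair_closed_Vset: "inaccessible \<delta> \<Longrightarrow> vpair_closed (Vset \<delta>)"
  by (simp add: vpair_closed_def Transset_Vset vpair_in_countably_closed countably_closed_Vset)

lemma definable_Ord [definable_intro]: "definable C (\<lambda>X e. Ord (e i))"
  unfolding Ord_def Transset_def by (intro definable_intro)

definition lepoll_in :: "'v::zfc \<Rightarrow> 'v \<Rightarrow> 'v \<Rightarrow> bool"
  where "lepoll_in X A B \<longleftrightarrow> (\<exists>h. elts h \<subseteq> elts X \<and>
    (\<forall>a\<in>elts A. \<exists>b\<in>elts B. vpair a b \<in> elts h) \<and>
    (\<forall>a\<in>elts A. \<forall>a'\<in>elts A. \<forall>b\<in>elts B. vpair a b \<in> elts h \<longrightarrow> vpair a' b \<in> elts h \<longrightarrow> a = a'))"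

lemma definable_lepoll_in [definable_intro]: "definable C (\<lambda>X e. lepoll_in X (e i) (e j))"
  unfolding lepoll_in_def by (intro definable_intro)

lemma lepoll_in_iff:
  assumes X: "vpair_closed X" and AB: "elts A \<subseteq> elts X" "elts B \<subseteq> elts X"
  shows "lepoll_in X A B \<longleftrightarrow> elts A \<lesssim> elts B"
proof
  assume "lepoll_in X A B"
  then obtain h where "\<forall>a\<in>elts A. \<exists>b\<in>elts B. vpair a b \<in> elts h"
    and "\<forall>a\<in>elts A. \<forall>a'\<in>elts A. \<forall>b\<in>elts B. vpair a b \<in> elts h \<longrightarrow> vpair a' b \<in> elts h \<longrightarrow> a = a'"
    unfolding lepoll_in_def by blast
  then show "elts A \<lesssim> elts B"
    by (intro lepoll_relational_full[of _ _ "\<lambda>b a. vpair a b \<in> elts h"]) blast+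
next
  assume "elts A \<lesssim> elts B"
  then obtain f where f: "inj_on f (elts A)" "f ` elts A \<subseteq> elts B"
    unfolding lepoll_def by blast
  let ?h = "(\<lambda>a. vpair a (f a)) ` elts A"
  have "?h \<subseteq> elts X" using X AB f(2) unfolding vpair_closed_def by blast
  then have h: "elts (set_of ?h) = ?h" "elts (set_of ?h) \<subseteq> elts X"
    by (simp_all add: elts_set_of_subset)
  then have "vpair a b \<in> elts (set_of ?h) \<longleftrightarrow> a \<in> elts A \<and> b = f a" for a b by auto
  then show "lepoll_in X A B"
    unfolding lepoll_in_def using f h(2)
    by (intro exI[of _ "set_of ?h"]) (simp add: inj_on_def image_subset_iff)
qed

text \<open>The witness \<open>h\<close> is the graph \<open>{\<langle>\<alpha>, y\<rangle>. \<alpha> \<in> \<delta>, y \<in> V\<^sub>\<alpha>}\<close>.\<close>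
definition hierarchy_in :: "'v::zfc \<Rightarrow> 'v \<Rightarrow> bool"
  where "hierarchy_in X \<delta> \<longleftrightarrow> (\<exists>h. elts h \<subseteq> elts X \<and>
    (\<forall>\<alpha>\<in>elts \<delta>. \<forall>y. elts y \<subseteq> elts X \<longrightarrow>
      (vpair \<alpha> y \<in> elts h \<longleftrightarrow> (\<exists>\<beta>\<in>elts \<alpha>. \<forall>z\<in>elts y. vpair \<beta> z \<in> elts h))) \<and>
    (\<forall>y. elts y \<subseteq> elts X \<longrightarrow> (y \<in> elts X \<longleftrightarrow> (\<exists>\<beta>\<in>elts \<delta>. \<forall>z\<in>elts y. vpair \<beta> z \<in> elts h))))"

lemma definable_hierarchy_in [definable_intro]: "definable C (\<lambda>X e. hierarchy_in X (e i))"
  unfolding hierarchy_in_def by (intro definable_intro)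

lemma hierarchy_in_imp_eq_Vset:
  assumes "hierarchy_in X \<delta>" and X: "Transset X" and \<delta>: "Transset \<delta>"
  shows "X = Vset \<delta>"
proof -
  obtain h where hX: "elts h \<subseteq> elts X"
    and levels: "\<forall>\<alpha>\<in>elts \<delta>. \<forall>y. elts y \<subseteq> elts X \<longrightarrow>
      (vpair \<alpha> y \<in> elts h \<longleftrightarrow> (\<exists>\<beta>\<in>elts \<alpha>. \<forall>z\<in>elts y. vpair \<beta> z \<in> elts h))"
    and top: "\<forall>y. elts y \<subseteq> elts X \<longrightarrow>
      (y \<in> elts X \<longleftrightarrow> (\<exists>\<beta>\<in>elts \<delta>. \<forall>z\<in>elts y. vpair \<beta> z \<in> elts h))"
    using assms(1) unfolding hierarchy_in_def by (elim exE conjE) (rule that)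
  have in_X_if_pair: "y \<in> elts X" if "vpair \<alpha> y \<in> elts h" for \<alpha> y
    using vpair_in_TranssetD(2)[OF X] hX that by blast
  have subset_X: "elts y \<subseteq> elts X" if "y \<in> elts X" for y
    using X that by (simp add: Transset_def)
  have subset_X_if_below: "elts y \<subseteq> elts X" if "\<exists>\<beta>\<in>elts \<alpha>. \<forall>z\<in>elts y. vpair \<beta> z \<in> elts h" for \<alpha> y
    using that in_X_if_pair by blast
  have "vpair \<alpha> y \<in> elts h \<longleftrightarrow> y \<in> elts (Vset \<alpha>)" if "\<alpha> \<in> elts \<delta>" for \<alpha> y
    using that
  proof (induction \<alpha> arbitrary: y rule: elts_induct)
    case (step \<alpha>)
    have "(\<exists>\<beta>\<in>elts \<alpha>. \<forall>z\<in>elts y. vpair \<beta> z \<in> elts h) \<longleftrightarrow> y \<in> elts (Vset \<alpha>)"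
      using step.IH TranssetD[OF \<delta> step.prems] by (simp add: mem_Vset_iff[of y] subset_eq)
    then show ?case
      using levels step.prems in_X_if_pair[of \<alpha> y] subset_X[of y] subset_X_if_below[of \<alpha> y] by metis
  qed
  then have "(\<exists>\<beta>\<in>elts \<delta>. \<forall>z\<in>elts y. vpair \<beta> z \<in> elts h) \<longleftrightarrow> y \<in> elts (Vset \<delta>)" for y
    by (simp add: mem_Vset_iff[of y] subset_eq)
  then have "y \<in> elts X \<longleftrightarrow> y \<in> elts (Vset \<delta>)" for y
    using top subset_X[of y] subset_X_if_below[of \<delta> y] by metis
  then show ?thesis by (intro extensionality) blast
qed

lemma hierarchy_in_Vset:
  assumes "vpair_closed (Vset \<delta>)" "Transset \<delta>"
  shows "hierarchy_in (Vset \<delta>) \<delta>"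
proof -
  let ?X = "Vset \<delta>"
  let ?h = "{vpair \<alpha> y | \<alpha> y. \<alpha> \<in> elts \<delta> \<and> y \<in> elts (Vset \<alpha>)}"
  have "?h \<subseteq> elts ?X"
    using assms(1) elts_subset_Vset[of \<delta>] Vset_mono[of _ \<delta>] unfolding vpair_closed_def by blast
  then have h: "elts (set_of ?h) = ?h" "elts (set_of ?h) \<subseteq> elts ?X"
    by (simp_all add: elts_set_of_subset)
  then have mem: "vpair \<alpha> y \<in> elts (set_of ?h) \<longleftrightarrow> \<alpha> \<in> elts \<delta> \<and> y \<in> elts (Vset \<alpha>)" for \<alpha> y
    by simp
  have level: "(\<exists>\<beta>\<in>elts \<alpha>. \<forall>z\<in>elts y. vpair \<beta> z \<in> elts (set_of ?h)) \<longleftrightarrow> y \<in> elts (Vset \<alpha>)"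
    if "elts \<alpha> \<subseteq> elts \<delta>" for \<alpha> y
    unfolding mem mem_Vset_iff[of y \<alpha>] using that by blast
  have "elts \<alpha> \<subseteq> elts \<delta>" if "\<alpha> \<in> elts \<delta>" for \<alpha>
    using assms(2) that by (simp add: Transset_def)
  then have "vpair \<alpha> y \<in> elts (set_of ?h) \<longleftrightarrow>
      (\<exists>\<beta>\<in>elts \<alpha>. \<forall>z\<in>elts y. vpair \<beta> z \<in> elts (set_of ?h))"
    if "\<alpha> \<in> elts \<delta>" for \<alpha> y
    using level[of \<alpha> y] mem that by blast
  then show ?thesis
    unfolding hierarchy_in_def
    by (intro exI[of _ "set_of ?h"] conjI ballI allI impI h(2) level[OF subset_refl, symmetric])
qed

definition inaccessible_in :: "'v::zfc \<Rightarrow> 'v \<Rightarrow> bool"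
  where "inaccessible_in X \<delta> \<longleftrightarrow> Ord \<delta> \<and> \<not> lepoll_in X \<delta> omega \<and>
    (\<forall>Y. elts Y \<subseteq> elts X \<longrightarrow> elts Y \<subseteq> elts \<delta> \<longrightarrow> \<not> lepoll_in X \<delta> Y \<longrightarrow>
      (\<exists>\<beta>\<in>elts \<delta>. elts Y \<subseteq> elts \<beta>)) \<and>
    (\<forall>\<alpha>\<in>elts \<delta>. \<forall>P. elts P \<subseteq> elts X \<longrightarrow>
      (\<forall>y. elts y \<subseteq> elts X \<longrightarrow> (y \<in> elts P \<longleftrightarrow> elts y \<subseteq> elts \<alpha>)) \<longrightarrow> \<not> lepoll_in X \<delta> P)"

lemma definable_inaccessible_in [definable_intro]:
  assumes "omega \<in> C"
  shows "definable C (\<lambda>X e. inaccessible_in X (e i))"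
proof -
  have "definable C (\<lambda>X e. lepoll_in X (e j) omega)" for j
    by (rule definable_const[where Q = "\<lambda>X e w. lepoll_in X (e j) w"])
      (intro definable_intro assms)+
  then show ?thesis
    unfolding inaccessible_in_def by (intro definable_intro)
qed

lemma eq_vpow_iff_in_Vset:
  assumes "x \<in> elts (Vset \<alpha>)"
  shows "P = vpow x \<longleftrightarrow> elts P \<subseteq> elts (Vset \<alpha>) \<and>
    (\<forall>y. elts y \<subseteq> elts (Vset \<alpha>) \<longrightarrow> (y \<in> elts P \<longleftrightarrow> elts y \<subseteq> elts x))" (is "_ \<longleftrightarrow> ?R")
proof
  have in_Vset: "y \<in> elts (Vset \<alpha>)" if "elts y \<subseteq> elts x" for y
    using assms that by (rule Vset_subset_closed)
  have subset_Vset: "elts y \<subseteq> elts (Vset \<alpha>)" if "y \<in> elts (Vset \<alpha>)" for y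
    using Transset_Vset[of \<alpha>] that by (simp add: Transset_def)
  show ?R if "P = vpow x" using that in_Vset by auto
  assume ?R
  then have "y \<in> elts P \<longleftrightarrow> elts y \<subseteq> elts x" for y
    using in_Vset[of y] subset_Vset[of y] by (meson subsetD)
  then show "P = vpow x" by (intro extensionality) auto
qed

lemma inaccessible_in_Vset_iff:
  assumes X: "vpair_closed (Vset \<delta>)" "elts omega \<subseteq> elts (Vset \<delta>)"
  shows "inaccessible_in (Vset \<delta>) \<delta> \<longleftrightarrow> inaccessible \<delta>"
proof -
  let ?X = "Vset \<delta>"
  have lepoll: "lepoll_in ?X \<delta> Y \<longleftrightarrow> elts \<delta> \<lesssim> elts Y" if "elts Y \<subseteq> elts ?X" for Y
    using X(1) elts_subset_Vset that by (rule lepoll_in_iff)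
  have regular: "(\<forall>Y. elts Y \<subseteq> elts ?X \<longrightarrow> elts Y \<subseteq> elts \<delta> \<longrightarrow> \<not> lepoll_in ?X \<delta> Y \<longrightarrow> P Y) \<longleftrightarrow>
    (\<forall>Y. elts Y \<subseteq> elts \<delta> \<longrightarrow> \<not> elts \<delta> \<lesssim> elts Y \<longrightarrow> P Y)" for P
    using lepoll elts_subset_Vset[of \<delta>] by (metis subset_trans)
  have strong: "(\<forall>P. elts P \<subseteq> elts ?X \<longrightarrow>
      (\<forall>y. elts y \<subseteq> elts ?X \<longrightarrow> (y \<in> elts P \<longleftrightarrow> elts y \<subseteq> elts \<alpha>)) \<longrightarrow> \<not> lepoll_in ?X \<delta> P) \<longleftrightarrow>
    \<not> elts \<delta> \<lesssim> elts (vpow \<alpha>)" if "\<alpha> \<in> elts \<delta>" for \<alpha>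
  proof -
    have "\<alpha> \<in> elts ?X" using that elts_subset_Vset by blast
    then show ?thesis using lepoll eq_vpow_iff_in_Vset[symmetric] by metis
  qed
  show ?thesis
    unfolding inaccessible_in_def inaccessible_iff regular lepoll[OF X(2)]
    using strong by (simp cong: ball_cong)
qed

definition inaccessible_level :: "'v::zfc \<Rightarrow> bool"
  where "inaccessible_level X \<longleftrightarrow> (\<exists>\<delta>. inaccessible \<delta> \<and> X = Vset \<delta>)"

lemma inaccessible_level_iff:
  "inaccessible_level X \<longleftrightarrow> vpair_closed X \<and> elts omega \<subseteq> elts X \<and>
    (\<exists>\<delta>. elts \<delta> \<subseteq> elts X \<and> hierarchy_in X \<delta> \<and> inaccessible_in X \<delta>)" (is "_ \<longleftrightarrow> ?R")
proof
  assume "inaccessible_level X"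
  then obtain \<delta> where "inaccessible \<delta>" "X = Vset \<delta>" unfolding inaccessible_level_def by blast
  moreover have "Transset \<delta>"
    using calculation(1) by (simp add: inaccessible_def regular_def Card_def Ord_def)
  ultimately show ?R
    using vpair_closed_Vset omega_subset_Vset elts_subset_Vset hierarchy_in_Vset
      inaccessible_in_Vset_iff by metis
next
  assume ?R
  then obtain \<delta> where "vpair_closed X" "elts omega \<subseteq> elts X" "hierarchy_in X \<delta>"
    "inaccessible_in X \<delta>" by blast
  moreover have "X = Vset \<delta>"
    using calculation
    by (intro hierarchy_in_imp_eq_Vset) (simp_all add: vpair_closed_def inaccessible_in_def Ord_def)
  ultimately show "inaccessible_level X"
    using inaccessible_in_Vset_iff unfolding inaccessible_level_def by metis
qed

lemma Transset_inaccessible_level: "inaccessible_level X \<Longrightarrow> Transset X"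
  by (auto simp: inaccessible_level_def Transset_Vset)

lemma definable_inaccessible_level:
  assumes "omega \<in> C"
  shows "definable C (\<lambda>X e. inaccessible_level X)"
proof -
  have "definable C (\<lambda>X e. elts omega \<subseteq> elts X)"
    by (rule definable_const[where Q = "\<lambda>X e w. elts w \<subseteq> elts X"]) (intro definable_intro assms)+
  then show ?thesis
    unfolding inaccessible_level_iff by (intro definable_intro assms)
qed

section \<open>Second-order satisfaction as first-order satisfaction over the power set\<close>

text \<open>In the clause for \<open>All2\<close>, being an element of \<open>X\<close> is expressed over \<open>\<P>(X)\<close> as being an element
  of something.\<close>
primrec so_to_fo :: "fm2 \<Rightarrow> fm" where
  "so_to_fo (Mem2 i j) = Mem (2 * i) (2 * j)"
| "so_to_fo (Eq2 i j) = Eq (2 * i) (2 * j)"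
| "so_to_fo (MemC2 i j) = Mem (2 * i) (2 * j + 1)"
| "so_to_fo (Neg2 p) = Neg (so_to_fo p)"
| "so_to_fo (And2 p q) = And (so_to_fo p) (so_to_fo q)"
| "so_to_fo (All2 i p) = All (2 * i)
    (Neg (And (Neg (All (2 * i + 1) (Neg (Mem (2 * i) (2 * i + 1))))) (Neg (so_to_fo p))))"
| "so_to_fo (AllC2 j p) = All (2 * j + 1) (so_to_fo p)"

lemma sat_so_to_fo:
  assumes X: "Transset X"
  shows "sat (vpow X) e (so_to_fo p) \<longleftrightarrow> sat2 X (\<lambda>i. e (2 * i)) (\<lambda>j. elts (e (2 * j + 1))) p"
proof (induction p arbitrary: e)
  case (All2 i p)
  have "sat (vpow X) e (so_to_fo (All2 i p)) \<longleftrightarrow>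
      (\<forall>a\<in>elts (vpow X). (\<exists>b\<in>elts (vpow X). a \<in> elts b) \<longrightarrow>
        sat (vpow X) (e(2 * i := a)) (so_to_fo p))"
    by auto
  also have "\<dots> \<longleftrightarrow> (\<forall>a\<in>elts X. sat (vpow X) (e(2 * i := a)) (so_to_fo p))"
    using X unfolding Transset_def elts_vpow by blast
  finally have "sat (vpow X) e (so_to_fo (All2 i p)) \<longleftrightarrow> \<dots>" .
  moreover have "(\<lambda>k. (e(2 * i := a)) (2 * k)) = (\<lambda>k. e (2 * k))(i := a)"
    "(\<lambda>k. elts ((e(2 * i := a)) (2 * k + 1))) = (\<lambda>k. elts (e (2 * k + 1)))" for a
    by (auto simp: fun_eq_iff double_not_eq_Suc_double Suc_double_not_eq_double)
  ultimately show ?case by (simp add: All2.IH)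
next
  case (AllC2 j p)
  have "(\<lambda>k. (e(2 * j + 1 := a)) (2 * k)) = (\<lambda>k. e (2 * k))"
    "(\<lambda>k. elts ((e(2 * j + 1 := a)) (2 * k + 1))) = (\<lambda>k. elts (e (2 * k + 1)))(j := elts a)" for a
    by (auto simp: fun_eq_iff double_not_eq_Suc_double Suc_double_not_eq_double)
  moreover have "(\<forall>A\<subseteq>elts X. P A) \<longleftrightarrow> (\<forall>a. elts a \<subseteq> elts X \<longrightarrow> P (elts a))" for P
    by (metis elts_set_of_subset)
  ultimately show ?case by (simp add: AllC2.IH)
qed simp_all

lemma so_models_iff:
  assumes "Transset X" "so_theory T"
  shows "so_models X T \<longleftrightarrow> (\<forall>p\<in>T. sat (vpow X) a (so_to_fo p))"
proof -
  have "sat2 X e E p \<longleftrightarrow> sat (vpow X) a (so_to_fo p)" if "p \<in> T" for e E p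
    unfolding sat_so_to_fo[OF assms(1)]
    using assms(2) that by (intro sat2_cong) (auto simp: so_theory_def)
  then show ?thesis unfolding so_models_def by blast
qed

section \<open>Assignments coded by sets of pairs\<close>

definition row :: "'v::zfc \<Rightarrow> 'v \<Rightarrow> 'v"
  where "row F a = set_of {x. vpair a x \<in> elts F}"

lemma elts_row: "elts (row F a) = {x. vpair a x \<in> elts F}"
proof -
  have "{x. vpair a x \<in> elts F} \<subseteq> (\<lambda>z. THE x. z = vpair a x) ` elts F"
    by (force simp: image_iff)
  then show ?thesis
    unfolding row_def by (intro elts_set_of small_subset[OF small_image[OF small_elts]])
qed

lemma eq_row_iff:
  "y = row F a \<longleftrightarrow> (\<forall>x\<in>elts y. vpair a x \<in> elts F) \<and> (\<forall>x\<in>elts (row F a). x \<in> elts y)"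
  by (auto simp: elts_row elts_eq_iff[symmetric])

lemma definable_ball_row [definable_intro]:
  fixes C :: "'v::zfc set"
  assumes "definable C (\<lambda>X e. Q X (\<lambda>n. e (Suc n)) (e 0))"
  shows "definable C (\<lambda>X e. \<forall>x\<in>elts (row (e i) (e j)). Q X e x)"
  unfolding Ball_def elts_row mem_Collect_eq
proof (rule definable_all)
  show "definable C (\<lambda>X e. vpair (e (Suc j)) (e 0) \<in> elts (e (Suc i)) \<longrightarrow> Q X (\<lambda>n. e (Suc n)) (e 0))"
    by (rule definable_imp[OF definable_vpair_mem assms])
next
  fix M X and e :: "nat \<Rightarrow> 'v" and x
  assume M: "admissible C M X" "range e \<subseteq> elts M"
    and "\<not> (vpair (e j) x \<in> elts (e i) \<longrightarrow> Q X e x)"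
  then have "vpair (e j) x \<in> elts M" by (auto simp: admissible_def intro: TranssetD)
  then show "x \<in> elts M" using M(1) vpair_in_TranssetD(2) unfolding admissible_def by blast
qed

lemma definable_row_mem_row [definable_intro]:
  "definable C (\<lambda>X e. row (e i) (e j) \<in> elts (row (e k) (e l)))"
proof -
  have "definable C (\<lambda>X e. \<not> (\<forall>y\<in>elts (row (e k) (e l)). \<not> y = row (e i) (e j)))"
    unfolding eq_row_iff by (intro definable_intro)
  then show ?thesis by simp
qed

lemma definable_row_eq_row [definable_intro]:
  "definable C (\<lambda>X e. row (e i) (e j) = row (e k) (e l))"
proof -
  have "definable C (\<lambda>X e. (\<forall>x\<in>elts (row (e i) (e j)). vpair (e l) x \<in> elts (e k)) \<and>
      (\<forall>x\<in>elts (row (e k) (e l)). vpair (e j) x \<in> elts (e i)))"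
    by (intro definable_intro)
  then show ?thesis by (simp add: eq_row_iff elts_row)
qed

definition decode :: "'v::zfc \<Rightarrow> nat \<Rightarrow> 'v"
  where "decode F i = row F (code i)"

lemma ex_decode_update:
  fixes X :: "'v::zfc"
  assumes X: "vpair_closed X" "elts omega \<subseteq> elts X"
    and F: "elts F \<subseteq> elts X" and a: "elts a \<subseteq> elts X"
  shows "\<exists>G. elts G \<subseteq> elts X \<and> decode G = (decode F)(i := a)"
proof -
  let ?G = "{z \<in> elts F. \<forall>x. z \<noteq> vpair (code i) x} \<union> vpair (code i) ` elts a"
  have "?G \<subseteq> elts X"
    using X F a code_in_omega unfolding vpair_closed_def by blast
  then have G: "elts (set_of ?G) = ?G" "elts (set_of ?G) \<subseteq> elts X"
    by (simp_all add: elts_set_of_subset)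
  have "elts (decode (set_of ?G) j) = elts (((decode F)(i := a)) j)" for j
    by (auto simp: decode_def elts_row G(1))
  then have "decode (set_of ?G) = (decode F)(i := a)"
    by (intro ext extensionality)
  then show ?thesis using G(2) by blast
qed

lemma sat_All_decode_iff:
  fixes X :: "'v::zfc"
  assumes X: "vpair_closed X" "elts omega \<subseteq> elts X" and F: "elts F \<subseteq> elts X"
  shows "sat (vpow X) (decode F) (All i p) \<longleftrightarrow>
    (\<forall>G. elts G \<subseteq> elts X \<longrightarrow> (\<forall>j. j \<noteq> i \<longrightarrow> decode G j = decode F j) \<longrightarrow> sat (vpow X) (decode G) p)"
    (is "?L \<longleftrightarrow> ?R")
proof
  assume L: ?L
  show ?R
  proof (intro allI impI)
    fix G assume G: "elts G \<subseteq> elts X" "\<forall>j. j \<noteq> i \<longrightarrow> decode G j = decode F j"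
    then have "decode G = (decode F)(i := decode G i)" by auto
    moreover have "elts (decode G i) \<subseteq> elts X"
      using X(1) G(1) vpair_in_TranssetD(2) unfolding decode_def elts_row vpair_closed_def by blast
    ultimately show "sat (vpow X) (decode G) p"
      using L by (metis elts_vpow mem_Collect_eq sat.simps(5))
  qed
next
  assume R: ?R
  have "sat (vpow X) ((decode F)(i := a)) p" if a: "elts a \<subseteq> elts X" for a
  proof -
    obtain G where "elts G \<subseteq> elts X" "decode G = (decode F)(i := a)"
      using ex_decode_update[OF X F a] by blast
    then show ?thesis using R by (metis fun_upd_other)
  qed
  then show ?L by simp
qed

section \<open>Truth sets\<close>

instance fm :: countable
  by countable_datatype

definition truth_set :: "'v::zfc \<Rightarrow> 'v \<Rightarrow> bool"
  where "truth_set X S \<longleftrightarrow> (\<forall>F p. elts F \<subseteq> elts X \<longrightarrow>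
    (vpair (code p) F \<in> elts S \<longleftrightarrow> sat (vpow X) (decode F) p))"

lemma ex_truth_set:
  assumes "inaccessible \<kappa>" "X \<in> elts (Vset \<kappa>)" "Transset X" "elts omega \<subseteq> elts X"
  shows "\<exists>S\<in>elts (Vset \<kappa>). truth_set X S"
proof -
  let ?U = "vpow (vpow (vpow X))"
  let ?S = "{vpair (code p) F | p F. elts F \<subseteq> elts X \<and> sat (vpow X) (decode F) p}"
  have "vpair (code p) F \<in> elts ?U" if "elts F \<subseteq> elts X" for p :: fm and F
    using that assms(3,4) code_in_omega[of p] unfolding Transset_def by (auto simp: elts_vpair)
  then have sub: "?S \<subseteq> elts ?U" by blast
  then have S: "elts (set_of ?S) = ?S" by (rule elts_set_of_subset)
  have "set_of ?S \<in> elts (Vset \<kappa>)"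
  proof (rule Vset_subset_closed)
    show "?U \<in> elts (Vset \<kappa>)" using assms(1,2) by (intro vpow_in_Vset)
    show "elts (set_of ?S) \<subseteq> elts ?U" unfolding S by (rule sub)
  qed
  moreover have "truth_set X (set_of ?S)" by (simp add: truth_set_def S)
  ultimately show ?thesis by blast
qed

definition tarski_clauses :: "'v::zfc \<Rightarrow> 'v \<Rightarrow> bool"
  where "tarski_clauses X S \<longleftrightarrow> (\<forall>F. elts F \<subseteq> elts X \<longrightarrow>
    (\<forall>i j. vpair (code (Mem i j)) F \<in> elts S \<longleftrightarrow> decode F i \<in> elts (decode F j)) \<and>
    (\<forall>i j. vpair (code (Eq i j)) F \<in> elts S \<longleftrightarrow> decode F i = decode F j) \<and>
    (\<forall>p. vpair (code (Neg p)) F \<in> elts S \<longleftrightarrow> vpair (code p) F \<notin> elts S) \<and>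
    (\<forall>p q. vpair (code (And p q)) F \<in> elts S \<longleftrightarrow>
      vpair (code p) F \<in> elts S \<and> vpair (code q) F \<in> elts S) \<and>
    (\<forall>i p. vpair (code (All i p)) F \<in> elts S \<longleftrightarrow> (\<forall>G. elts G \<subseteq> elts X \<longrightarrow>
      (\<forall>j. j \<noteq> i \<longrightarrow> decode G j = decode F j) \<longrightarrow> vpair (code p) G \<in> elts S)))"

lemma truth_set_iff_tarski_clauses:
  assumes X: "vpair_closed X" "elts omega \<subseteq> elts X"
  shows "truth_set X S \<longleftrightarrow> tarski_clauses X S"
proof
  assume "truth_set X S"
  then show "tarski_clauses X S"
    by (simp add: truth_set_def tarski_clauses_def sat_All_decode_iff[OF X] del: sat.simps(5))
next
  assume S: "tarski_clauses X S"
  have "vpair (code p) F \<in> elts S \<longleftrightarrow> sat (vpow X) (decode F) p" if "elts F \<subseteq> elts X" for p F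
    using that
  proof (induction p arbitrary: F)
    case (All i p)
    then show ?case
      using S by (simp add: tarski_clauses_def sat_All_decode_iff[OF X] del: sat.simps(5))
  qed (use S in \<open>simp_all add: tarski_clauses_def\<close>)
  then show "truth_set X S" unfolding truth_set_def by blast
qed

definition binary_table :: "('a::countable \<Rightarrow> 'b::countable \<Rightarrow> 'c::countable) \<Rightarrow> 'v::zfc"
  where "binary_table f = set_of (range (\<lambda>(x, y). vpair (code x) (vpair (code y) (code (f x y)))))"

lemma mem_binary_table_iff:
  "vpair a (vpair b c) \<in> elts (binary_table f) \<longleftrightarrow>
    (\<exists>x y. a = code x \<and> b = code y \<and> c = code (f x y))"
  by (auto simp: binary_table_def elts_set_of_countable)

lemma binary_table_in_countably_closed: "countably_closed C \<Longrightarrow> binary_table f \<in> C"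
  unfolding binary_table_def
  by (rule countably_closedD) (auto intro!: vpair_in_countably_closed code_in_countably_closed)

lemma definable_ball_code:
  fixes C :: "'v::zfc set" and A :: "'a::countable set"
  assumes C: "countably_closed C" and Q: "definable C (\<lambda>X e. Q X (\<lambda>n. e (Suc n)) (e 0))"
  shows "definable C (\<lambda>X e. \<forall>x\<in>A. Q X e (code x))"
proof -
  have "code ` A \<subseteq> C" using code_in_countably_closed[OF C] by blast
  then have "set_of (code ` A) \<in> C" using C by (intro countably_closedD) auto
  then have "definable C (\<lambda>X e. \<forall>a\<in>elts (set_of (code ` A)). Q X e a)"
    using Q by (intro definable_ball_const)
  then show ?thesis by (simp add: elts_set_of_countable)
qed

lemma definable_all_code_binary:
  fixes f :: "'a::countable \<Rightarrow> 'b::countable \<Rightarrow> 'c::countable" and C :: "'v::zfc set"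
  assumes C: "countably_closed C"
    and Q: "definable C (\<lambda>X e. Q X (\<lambda>n. e (Suc (Suc (Suc n)))) (e 2) (e 1) (e 0))"
  shows "definable C (\<lambda>X e. \<forall>x y. Q X e (code x) (code y) (code (f x y)))"
proof -
  have "definable C (\<lambda>X e. vpair (e 2) (vpair (e 1) (e 0)) \<in> elts (binary_table f))"
    by (rule definable_const[where Q = "\<lambda>X e t. vpair (e 2) (vpair (e 1) (e 0)) \<in> elts t"])
      (intro definable_triple_mem binary_table_in_countably_closed C)+
  then have "definable C (\<lambda>X e. \<forall>a\<in>elts omega. \<forall>b\<in>elts omega. \<forall>c\<in>elts omega.
      vpair a (vpair b c) \<in> elts (binary_table f) \<longrightarrow> Q X e a b c)"
    using Q omega_in_countably_closed[OF C]
    by (intro definable_ball_const definable_imp) (simp_all add: numeral_2_eq_2)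
  moreover have "(\<forall>a\<in>elts (omega :: 'v). \<forall>b\<in>elts omega. \<forall>c\<in>elts omega.
      vpair a (vpair b c) \<in> elts (binary_table f) \<longrightarrow> P a b c) \<longleftrightarrow>
    (\<forall>x y. P (code x) (code y) (code (f x y)))" for P
    unfolding mem_binary_table_iff by (metis code_in_omega)
  ultimately show ?thesis by simp
qed

lemma definable_all_code_unary:
  fixes f :: "'a::countable \<Rightarrow> 'b::countable"
  assumes "countably_closed C" "definable C (\<lambda>X e. Q X (\<lambda>n. e (Suc (Suc (Suc n)))) (e 1) (e 0))"
  shows "definable C (\<lambda>X e. \<forall>x. Q X e (code x) (code (f x)))"
  using definable_all_code_binary[where f = "\<lambda>(_ :: unit). f" and Q = "\<lambda>X e _. Q X e", OF assms]
  by simp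

lemma definable_tarski_clauses:
  fixes C :: "'v::zfc set"
  assumes C: "countably_closed C"
  shows "definable C (\<lambda>X e. tarski_clauses X (e i))"
proof -
  have mem: "definable C (\<lambda>X e. \<forall>x y. vpair (code (Mem x y)) (e k) \<in> elts (e l) \<longleftrightarrow>
      row (e k) (code x) \<in> elts (row (e k) (code y)))" for k l
    by (rule definable_all_code_binary[where Q = "\<lambda>X e a b c. vpair c (e k) \<in> elts (e l) \<longleftrightarrow>
      row (e k) a \<in> elts (row (e k) b)", OF C]) (intro definable_intro)
  have eq: "definable C (\<lambda>X e. \<forall>x y. vpair (code (Eq x y)) (e k) \<in> elts (e l) \<longleftrightarrow>
      row (e k) (code x) = row (e k) (code y))" for k l
    by (rule definable_all_code_binary[where Q = "\<lambda>X e a b c. vpair c (e k) \<in> elts (e l) \<longleftrightarrow>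
      row (e k) a = row (e k) b", OF C]) (intro definable_intro)
  have neg: "definable C (\<lambda>X e. \<forall>p. vpair (code (Neg p)) (e k) \<in> elts (e l) \<longleftrightarrow>
      vpair (code p) (e k) \<notin> elts (e l))" for k l
    by (rule definable_all_code_unary[where Q = "\<lambda>X e a c. vpair c (e k) \<in> elts (e l) \<longleftrightarrow>
      vpair a (e k) \<notin> elts (e l)", OF C]) (intro definable_intro)
  have conj: "definable C (\<lambda>X e. \<forall>p q. vpair (code (And p q)) (e k) \<in> elts (e l) \<longleftrightarrow>
      vpair (code p) (e k) \<in> elts (e l) \<and> vpair (code q) (e k) \<in> elts (e l))" for k l
    by (rule definable_all_code_binary[where Q = "\<lambda>X e a b c. vpair c (e k) \<in> elts (e l) \<longleftrightarrow>
      vpair a (e k) \<in> elts (e l) \<and> vpair b (e k) \<in> elts (e l)", OF C]) (intro definable_intro)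
  have agree: "definable C (\<lambda>X e. \<forall>j\<in>(UNIV :: nat set). code j \<noteq> e m \<longrightarrow>
      row (e n) (code j) = row (e k) (code j))" for m n k
    by (rule definable_ball_code[where Q = "\<lambda>X e a. a \<noteq> e m \<longrightarrow> row (e n) a = row (e k) a", OF C])
      (intro definable_intro)
  have all: "definable C (\<lambda>X e. \<forall>x p. vpair (code (All x p)) (e k) \<in> elts (e l) \<longleftrightarrow>
      (\<forall>G. elts G \<subseteq> elts X \<longrightarrow>
        (\<forall>j\<in>(UNIV :: nat set). code j \<noteq> (code x :: 'v) \<longrightarrow> row G (code j) = row (e k) (code j)) \<longrightarrow>
        vpair (code p) G \<in> elts (e l)))" for k l
    by (rule definable_all_code_binary[where Q = "\<lambda>X e a b c. vpair c (e k) \<in> elts (e l) \<longleftrightarrow>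
      (\<forall>G. elts G \<subseteq> elts X \<longrightarrow>
        (\<forall>j\<in>(UNIV :: nat set). code j \<noteq> a \<longrightarrow> row G (code j) = row (e k) (code j)) \<longrightarrow>
        vpair b G \<in> elts (e l))", OF C]) (intro definable_intro agree)
  show ?thesis
    unfolding tarski_clauses_def decode_def using mem eq neg conj all
    by (intro definable_intro) (simp_all)
qed

lemma definable_level_truth_set:
  assumes C: "countably_closed C"
  shows "definable C (\<lambda>X e. inaccessible_level X \<and> truth_set X (e i))"
proof -
  have "inaccessible_level X \<and> truth_set X S \<longleftrightarrow> inaccessible_level X \<and> tarski_clauses X S"
    for X S :: 'a
    using truth_set_iff_tarski_clauses[of X S] by (auto simp: inaccessible_level_iff)
  then show ?thesis
    by (simp add: definable_conj definable_inaccessible_level definable_tarski_clauses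
        omega_in_countably_closed C)
qed

section \<open>Reflection\<close>

lemma elem_substructure_sat_iff:
  "elem_substructure N M \<Longrightarrow> range e \<subseteq> elts N \<Longrightarrow> sat N e p \<longleftrightarrow> sat M e p"
  unfolding elem_substructure_def by blast

lemma ex_formula_if_definable:
  fixes C :: "'v::zfc set"
  assumes "definable C (\<lambda>X e. Q X (e 0))" "C \<noteq> {}"
  shows "\<exists>p k. range k \<subseteq> C \<and> (\<forall>M X S. admissible C M X \<longrightarrow> S \<in> elts M \<longrightarrow>
    (sat M (k(0 := X, 1 := S)) p \<longleftrightarrow> Q X S))"
proof -
  obtain c where "c \<in> C" using assms(2) by blast
  obtain q v where q: "uniformly_defines C q v (\<lambda>X e. Q X (e 0))"
    using assms(1) by (rule definableE)
  let ?f = "\<lambda>i. case v i of Base \<Rightarrow> 0 | Const _ \<Rightarrow> i + 2 | Var _ \<Rightarrow> 1"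
  let ?k = "\<lambda>i. case v (i - 2) of Const a \<Rightarrow> a | _ \<Rightarrow> c"
  obtain p where p: "\<And>(M :: 'v) e. sat M e p \<longleftrightarrow> sat M (e \<circ> ?f) q"
    using ex_fm_renaming by metis
  have v: "set_param (v i) \<subseteq> C" for i using q by (simp add: uniformly_defines_def)
  have "?k i \<in> C" for i
    using v[of "i - 2"] \<open>c \<in> C\<close> by (cases "v (i - 2)") simp_all
  moreover have "sat M (?k(0 := X, 1 := S)) p \<longleftrightarrow> Q X S"
    if "admissible C M X" "S \<in> elts M" for M X S
  proof -
    have "(?k(0 := X, 1 := S)) \<circ> ?f = param_val X (\<lambda>_. S) \<circ> v"
      by (auto simp: fun_eq_iff split: param.split)
    then show ?thesis
      unfolding p using uniformly_defines_sat_iff[OF q that(1), of "\<lambda>_. S"] that(2) by simp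
  qed
  ultimately show ?thesis by (intro exI[of _ p] exI[of _ ?k]) auto
qed

lemma elementary_reflects_definable:
  assumes elem: "elem_substructure N M" and N: "\<And>X. X \<in> elts N \<Longrightarrow> admissible (elts N) N X"
    and M: "admissible (elts N) M X" and S: "S \<in> elts M"
    and Q: "definable (elts N) (\<lambda>X e. Q X (e 0))" "Q X S"
    and "elts N \<noteq> {}"
  shows "\<exists>X\<in>elts N. \<exists>S\<in>elts N. Q X S"
proof -
  obtain p k where k: "range k \<subseteq> elts N"
    and p: "\<And>M X S. admissible (elts N) M X \<Longrightarrow> S \<in> elts M \<Longrightarrow>
      sat M (k(0 := X, 1 := S)) p \<longleftrightarrow> Q X S"
    using ex_formula_if_definable[OF Q(1) \<open>elts N \<noteq> {}\<close>] by meson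
  have "X \<in> elts M" using M by (auto simp: admissible_def)
  then have "\<not> sat M k (All 0 (All 1 (Neg p)))" using p[OF M S] Q(2) S by auto
  then have "\<not> sat N k (All 0 (All 1 (Neg p)))"
    using elem_substructure_sat_iff[OF elem k] by blast
  then show ?thesis using p[OF N] by auto
qed

lemma elementary_lifts_definable:
  assumes elem: "elem_substructure N M" and N: "\<And>X. X \<in> elts N \<Longrightarrow> admissible (elts N) N X"
    and M: "admissible (elts N) M X"
    and Q: "definable (elts N) (\<lambda>X e. Q X (e 0))" "\<And>X. X \<in> elts N \<Longrightarrow> \<exists>S\<in>elts N. Q X S"
    and "elts N \<noteq> {}"
  shows "\<exists>S\<in>elts M. Q X S"
proof -
  obtain p k where k: "range k \<subseteq> elts N"
    and p: "\<And>M X S. admissible (elts N) M X \<Longrightarrow> S \<in> elts M \<Longrightarrow>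
      sat M (k(0 := X, 1 := S)) p \<longleftrightarrow> Q X S"
    using ex_formula_if_definable[OF Q(1) \<open>elts N \<noteq> {}\<close>] by meson
  have "sat N k (All 0 (Neg (All 1 (Neg p))))" using p[OF N] Q(2) by auto
  then have "sat M k (All 0 (Neg (All 1 (Neg p))))"
    using elem_substructure_sat_iff[OF elem k] by blast
  moreover have "X \<in> elts M" using M by (auto simp: admissible_def)
  ultimately show ?thesis using p[OF M] by auto
qed

lemma admissible_Vset: "X \<in> elts (Vset \<alpha>) \<Longrightarrow> admissible (elts (Vset \<alpha>)) (Vset \<alpha>) X"
  using Vset_subset_closed by (auto simp: admissible_def Transset_Vset)

lemma ex_truth_set_of_elementary:
  assumes \<kappa>: "inaccessible \<kappa>" and elem: "elem_substructure (Vset \<kappa>) M"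
    and M: "admissible (elts (Vset \<kappa>)) M (Vset \<kappa>)"
  shows "\<exists>S\<in>elts M. truth_set (Vset \<kappa>) S"
proof -
  let ?C = "elts (Vset \<kappa>)"
  have C: "countably_closed ?C" using \<kappa> by (rule countably_closed_Vset)
  then have omega: "omega \<in> ?C" by (rule omega_in_countably_closed)
  have "\<exists>S\<in>elts M. inaccessible_level (Vset \<kappa>) \<longrightarrow> inaccessible_level (Vset \<kappa>) \<and> truth_set (Vset \<kappa>) S"
    using elem admissible_Vset M
  proof (rule elementary_lifts_definable)
    show "definable ?C (\<lambda>X e. inaccessible_level X \<longrightarrow> inaccessible_level X \<and> truth_set X (e 0))"
      by (intro definable_imp definable_inaccessible_level definable_level_truth_set omega C)
    show "?C \<noteq> {}" using omega by blast
    fix X assume X: "X \<in> ?C"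
    show "\<exists>S\<in>?C. inaccessible_level X \<longrightarrow> inaccessible_level X \<and> truth_set X S"
    proof (cases "inaccessible_level X")
      case True
      then show ?thesis
        using ex_truth_set[OF \<kappa> X Transset_inaccessible_level] by (simp add: inaccessible_level_iff)
    qed (use X in blast)
  qed
  then show ?thesis using \<kappa> unfolding inaccessible_level_def by blast
qed

lemma so_models_iff_truth_set:
  assumes "truth_set X S" "Transset X" "so_theory T"
  shows "so_models X T \<longleftrightarrow>
    (\<forall>p\<in>so_to_fo ` T. \<forall>F. elts F \<subseteq> elts X \<longrightarrow> vpair (code p) F \<in> elts S)"
proof -
  have "so_models X T \<longleftrightarrow> (\<forall>p\<in>so_to_fo ` T. vpair (code p) F \<in> elts S)"
    if "elts F \<subseteq> elts X" for F
    using assms(1) that so_models_iff[OF assms(2,3), of "decode F"] by (simp add: truth_set_def)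
  then show ?thesis by blast
qed

lemma so_models_reflects:
  assumes \<kappa>: "inaccessible \<kappa>" and elem: "elem_substructure (Vset \<kappa>) M"
    and M: "admissible (elts (Vset \<kappa>)) M (Vset \<kappa>)"
    and T: "so_theory T" "so_models (Vset \<kappa>) T"
  shows "\<exists>\<mu>. inaccessible \<mu> \<and> \<mu> \<noteq> \<kappa> \<and> so_models (Vset \<mu>) T"
proof -
  let ?C = "elts (Vset \<kappa>)"
  let ?Q = "\<lambda>X S. (inaccessible_level X \<and> truth_set X S) \<and>
    (\<forall>p\<in>so_to_fo ` T. \<forall>F. elts F \<subseteq> elts X \<longrightarrow> vpair (code p) F \<in> elts S)"
  have C: "countably_closed ?C" using \<kappa> by (rule countably_closed_Vset)
  have Q: "?Q X S \<longleftrightarrow> inaccessible_level X \<and> truth_set X S \<and> so_models X T" for X S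
    using so_models_iff_truth_set[of X S, OF _ Transset_inaccessible_level T(1)] by blast
  obtain S where S: "S \<in> elts M" "truth_set (Vset \<kappa>) S"
    using ex_truth_set_of_elementary[OF \<kappa> elem M] by blast
  have "\<exists>X\<in>?C. \<exists>S\<in>?C. ?Q X S"
    using elem admissible_Vset M S(1)
  proof (rule elementary_reflects_definable)
    show "definable ?C (\<lambda>X e. ?Q X (e 0))"
      by (intro definable_conj definable_level_truth_set definable_all_subsets definable_vpair_mem C
          definable_ball_code[where Q = "\<lambda>X e c. \<forall>F. elts F \<subseteq> elts X \<longrightarrow> vpair c F \<in> elts (e 0)"])
    show "?Q (Vset \<kappa>) S" unfolding Q using \<kappa> S(2) T(2) by (auto simp: inaccessible_level_def)
    show "?C \<noteq> {}" using omega_in_countably_closed[OF C] by blast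
  qed
  then obtain X where "X \<in> ?C" "inaccessible_level X" "so_models X T" unfolding Q by blast
  then obtain \<mu> where "inaccessible \<mu>" "Vset \<mu> \<in> ?C" "so_models (Vset \<mu>) T"
    unfolding inaccessible_level_def by blast
  moreover have "\<mu> \<noteq> \<kappa>" using \<open>Vset \<mu> \<in> ?C\<close> elts_irrefl by blast
  ultimately show ?thesis by blast
qed

lemma fo_theory_categorical_imp_so:
  assumes "fo_theory_categorical \<kappa>" shows "so_theory_categorical \<kappa>"
proof -
  obtain T where T: "inaccessible \<kappa>" "fo_theory T" "fo_models (Vset \<kappa>) T"
      "\<forall>\<mu>. inaccessible \<mu> \<and> \<mu> \<noteq> \<kappa> \<longrightarrow> \<not> fo_models (Vset \<mu>) T"
    using assms unfolding fo_theory_categorical_def by blast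
  have "so_models M (fo_to_so ` T) \<longleftrightarrow> fo_models M T" for M :: 'a
    by (simp add: so_models_def fo_models_def)
  moreover have "so_theory (fo_to_so ` T)" using T(2) by (simp add: so_theory_def fo_theory_def)
  ultimately show ?thesis using T unfolding so_theory_categorical_def by blast
qed

theorem theorem12:
  fixes \<kappa> M :: "'v::zfc"
  assumes "Card \<kappa>"
    and "Transset M"
    and "elts (Vset (succ \<kappa>)) \<subseteq> elts M"
    and "elem_substructure (Vset \<kappa>) M"
  shows "\<not> fo_theory_categorical \<kappa> \<and> \<not> so_theory_categorical \<kappa>"
proof -
  have "admissible (elts (Vset \<kappa>)) M (Vset \<kappa>)"
    using assms(2-4) by (simp add: admissible_def elem_substructure_def Vset_succ)
  then have "\<not> so_theory_categorical \<kappa>"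
    using so_models_reflects[OF _ assms(4)] unfolding so_theory_categorical_def by metis
  then show ?thesis using fo_theory_categorical_imp_so by blast
qed

end
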